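(* Let $A$ be a nonempty set and $o\in A$. For every $n\in\mathbb N$ and every $\alpha\in S_A$, the Toffoli gate $TG(n,\alpha,o)$ can be realised with strong temporary storage by $\{TG(i,\alpha',o)\mid i\in\{1,2,3\},\ \alpha'\in S_A\}$.
   Context: $\mathbb N=\{1,2,3,\dots\}$. For a nonempty set $A$ and $n,m\in\mathbb N$, $M_{n,m}(A)$ is the set of all maps $f:A^n\to A^m$ (arity $n$, co-arity $m$), $M(A)=\bigcup_{n,m}M_{n,m}(A)$, and $f=(f_1,\dots,f_m)$ in components. $S_A$ is the set of permutations of $A$, and $B_n(A)$ is the set of bijections $A^n\to A^n$. Operations on $M(A)$, for $f\in M_{n,s}(A)$, $g\in M_{m,t}(A)$: - $i_1:A\to A$ is the identity (a constant, i.e. nullary operation); - $f\oplus g\in M_{n+m,s+t}(A)$, $(f\oplus g)(x_1,\dots,x_{n+m})=(f_1(x_1,\dots,x_n),\dots,f_s(x_1,\dots,x_n),g_1(x_{n+1},\dots,x_{n+m}),\dots,g_t(x_{n+1},\dots,x_{n+m}))$; - for $k\in\mathbb N$ with $k\le n$ and $k\le t$ (otherwise undefined), $f\circ_k g\in M_{n+m-k,s+t-k}(A)$ has $j$-th component, for $j\le s$, $f_j(g_1(x_1,\dots,x_m),\dots,g_k(x_1,\dots,x_m),x_{m+1},\dots,x_{m+n-k})$, and, for $s<j\le s+t-k$, $g_{k+j-s}(x_1,\dots,x_m)$; - $(\tau f)(x_1,\dots,x_n)=f(x_2,x_1,x_3,\dots,x_n)$, $(\zeta f)(x_1,\dots,x_n)=f(x_2,\dots,x_n,x_1)$,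 with $\tau f=\zeta f=f$ if $n=1$. A Toffoli algebra on $A$ is a subset of $M(A)$ containing $i_1$ and closed under $\oplus,\tau,\zeta$ and all partial operations $\circ_k$, $k\in\mathbb N$. For $F\subseteq M(A)$, $C(F)$ is the smallest Toffoli algebra containing $F$. Toffoli gates: for $\alpha\in S_A$, $o\in A$, $TG(1,\alpha,o)=\alpha$, and for $n\ge2$, $TG(n,\alpha,o)\in B_n(A)$ sends $(x_1,\dots,x_n)$ to $(x_1,\dots,x_{n-1},\alpha(x_n))$ if $x_1=\dots=x_{n-1}=o$, and fixes $(x_1,\dots,x_n)$ otherwise. A mapping $g\in M_{m,n}(A)$ is realised with strong temporary storage by $F\subseteq M(A)$ if there exist $l\ge m$, $k=n+l-m$, $f\in C(F)\cap M_{l,k}(A)$ and $a_1,\dots,a_{l-m}\in A$ such that: (i) $g_i(x_1,\dots,x_m)=f_i(x_1,\dots,x_m,a_1,\dots,a_{l-m})$ for all $i\in\{1,\dots,n\}$ and all $x_1,\dots,x_m\in A$; (ii) $f_{n+i}(x_1,\dots,x_m,a_1,\dots,a_{l-m})=a_i$ for all $i\in\{1,\dots,l-m\}$ and all $x_1,\dots,x_m\in A$; (iii) for all $b_1,\dots,b_m\in A$, the map $(x_1,\dots,x_{l-m})\mapsto(f_{n+1}(b_1,\dots,b_m,x_1,\dots,x_{l-m}),\dots,f_k(b_1,\dots,b_m,x_1,\dots,x_{l-m}))$ is a bijection of $A^{l-m}$. (Conditions (ii) and (iii) are vacuous if $l=m$.) *)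

theory Defs
  imports Main "HOL-Library.FuncSet"
begin

text \<open>
  The underlying nonempty set \<open>A\<close> is the type \<open>'a\<close>, and a tuple in \<open>A^n\<close> is a list of length \<open>n\<close>.
  A map from \<open>A^n\<close> to \<open>A^m\<close> is a function on lists that takes the dummy value \<open>[]\<close> outside
  its domain. As \<open>m \<ge> 1\<close>, the dummy is never an honest value, so a map determines its arity
  and co-arity (lemma \<open>maps_arity_unique\<close>).
\<close>

definition tuples :: "nat \<Rightarrow> 'a list set" where
  "tuples n = {xs. length xs = n}"

definition maps :: "nat \<Rightarrow> nat \<Rightarrow> ('a list \<Rightarrow> 'a list) set" where
  "maps n m = {f. (\<forall>xs\<in>tuples n. f xs \<in> tuples m) \<and> (\<forall>xs. xs \<notin> tuples n \<longrightarrow> f xs = [])}"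

definition all_maps :: "('a list \<Rightarrow> 'a list) set" where
  "all_maps = (\<Union>n\<in>{1..}. \<Union>m\<in>{1..}. maps n m)"

definition on_tuples :: "nat \<Rightarrow> ('a list \<Rightarrow> 'a list) \<Rightarrow> 'a list \<Rightarrow> 'a list" where
  "on_tuples n h = (\<lambda>xs. if xs \<in> tuples n then h xs else [])"

definition i1 :: "'a list \<Rightarrow> 'a list" where
  "i1 = on_tuples 1 (\<lambda>xs. xs)"

text \<open>
  In \<open>oplus n m f g\<close> and \<open>circ k n m f g\<close>, the numbers \<open>n\<close> and \<open>m\<close> are the arities of \<open>f\<close> and \<open>g\<close>.
\<close>

definition oplus ::
  "nat \<Rightarrow> nat \<Rightarrow> ('a list \<Rightarrow> 'a list) \<Rightarrow> ('a list \<Rightarrow> 'a list) \<Rightarrow> 'a list \<Rightarrow> 'a list" where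
  "oplus n m f g = on_tuples (n + m) (\<lambda>xs. f (take n xs) @ g (drop n xs))"

definition circ ::
  "nat \<Rightarrow> nat \<Rightarrow> nat \<Rightarrow> ('a list \<Rightarrow> 'a list) \<Rightarrow> ('a list \<Rightarrow> 'a list) \<Rightarrow> 'a list \<Rightarrow> 'a list" where
  "circ k n m f g = on_tuples (n + m - k)
     (\<lambda>xs. f (take k (g (take m xs)) @ drop m xs) @ drop k (g (take m xs)))"

definition tau :: "('a list \<Rightarrow> 'a list) \<Rightarrow> 'a list \<Rightarrow> 'a list" where
  "tau f = (\<lambda>xs. case xs of x # y # zs \<Rightarrow> f (y # x # zs) | _ \<Rightarrow> f xs)"

definition zeta :: "('a list \<Rightarrow> 'a list) \<Rightarrow> 'a list \<Rightarrow> 'a list" where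
  "zeta f = (\<lambda>xs. f (rotate1 xs))"

definition toffoli_algebra :: "('a list \<Rightarrow> 'a list) set \<Rightarrow> bool" where
  "toffoli_algebra T \<longleftrightarrow>
     T \<subseteq> all_maps \<and>
     i1 \<in> T \<and>
     (\<forall>n s m t f g. n \<ge> 1 \<and> s \<ge> 1 \<and> m \<ge> 1 \<and> t \<ge> 1 \<and> f \<in> T \<inter> maps n s \<and> g \<in> T \<inter> maps m t
        \<longrightarrow> oplus n m f g \<in> T) \<and>
     (\<forall>f\<in>T. tau f \<in> T) \<and>
     (\<forall>f\<in>T. zeta f \<in> T) \<and>
     (\<forall>k n s m t f g. n \<ge> 1 \<and> s \<ge> 1 \<and> m \<ge> 1 \<and> t \<ge> 1 \<and> f \<in> T \<inter> maps n s \<and> g \<in> T \<inter> maps m t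
        \<and> 1 \<le> k \<and> k \<le> n \<and> k \<le> t \<longrightarrow> circ k n m f g \<in> T)"

text \<open>
  For \<open>F \<subseteq> all_maps\<close> this is the smallest Toffoli algebra containing \<open>F\<close>
  (lemma \<open>toffoli_algebra_generated\<close>).
\<close>

definition generated :: "('a list \<Rightarrow> 'a list) set \<Rightarrow> ('a list \<Rightarrow> 'a list) set" where
  "generated F = \<Inter>{T. toffoli_algebra T \<and> F \<subseteq> T}"

definition TG :: "nat \<Rightarrow> ('a \<Rightarrow> 'a) \<Rightarrow> 'a \<Rightarrow> 'a list \<Rightarrow> 'a list" where
  "TG n \<alpha> c = on_tuples n (\<lambda>xs. if \<forall>i < n - 1. xs ! i = c then butlast xs @ [\<alpha> (last xs)] else xs)"

text \<open>The list \<open>as\<close> holds the constants in the temporary storage.\<close>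

definition realised_strong_temp ::
  "('a list \<Rightarrow> 'a list) set \<Rightarrow> nat \<Rightarrow> nat \<Rightarrow> ('a list \<Rightarrow> 'a list) \<Rightarrow> bool" where
  "realised_strong_temp F m n g \<longleftrightarrow>
     F \<subseteq> all_maps \<and> m \<ge> 1 \<and> n \<ge> 1 \<and> g \<in> maps m n \<and>
     (\<exists>l k f as. l \<ge> m \<and> k = n + l - m \<and> f \<in> generated F \<inter> maps l k \<and> as \<in> tuples (l - m) \<and>
        (\<forall>xs\<in>tuples m. g xs = take n (f (xs @ as))) \<and>
        (\<forall>xs\<in>tuples m. drop n (f (xs @ as)) = as) \<and>
        (\<forall>bs\<in>tuples m. bij_betw (\<lambda>xs. drop n (f (bs @ xs))) (tuples (l - m)) (tuples (l - m))))"

lemma maps_arity_unique: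
  assumes "f \<in> maps n m" "f \<in> maps n' m'" "m \<ge> 1" "m' \<ge> 1"
  shows "n = n'" "m = m'"
proof -
  have "f (replicate n undefined) \<in> tuples m"
    using assms(1) by (simp add: maps_def tuples_def)
  with assms(3) have *: "f (replicate n undefined) \<in> tuples m" "f (replicate n undefined) \<noteq> []"
    by (auto simp: tuples_def)
  with assms(2) have "replicate n (undefined :: 'a) \<in> tuples n'"
    by (auto simp: maps_def)
  then show "n = n'" by (simp add: tuples_def)
  with * assms(2) show "m = m'" by (simp add: maps_def tuples_def)
qed

lemma TG_in_maps: "n \<ge> 1 \<Longrightarrow> TG n \<alpha> c \<in> maps n n"
  by (auto simp: TG_def maps_def tuples_def on_tuples_def)

lemma TG_one: "TG 1 \<alpha> c [x] = [\<alpha> x]"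
  by (simp add: TG_def on_tuples_def tuples_def)

lemma TG_bij:
  assumes "n \<ge> 1" "bij \<alpha>"
  shows "bij_betw (TG n \<alpha> c) (tuples n) (tuples n)"
proof (rule bij_betwI[where g = "TG n (inv \<alpha>) c"])
  show "TG n \<alpha> c \<in> tuples n \<rightarrow> tuples n" "TG n (inv \<alpha>) c \<in> tuples n \<rightarrow> tuples n"
    using TG_in_maps[OF assms(1), of \<alpha> c] TG_in_maps[OF assms(1), of "inv \<alpha>" c]
    by (auto simp: maps_def)
next
  fix xs :: "'a list" assume "xs \<in> tuples n"
  then have "length xs = n" "xs = butlast xs @ [last xs]"
    using assms(1) by (auto simp: tuples_def intro!: append_butlast_last_id[symmetric])
  then obtain ys y where *: "xs = ys @ [y]" "length ys = n - 1" by (metis length_butlast)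
  show "TG n (inv \<alpha>) c (TG n \<alpha> c xs) = xs" "TG n \<alpha> c (TG n (inv \<alpha>) c xs) = xs"
    using assms *
    by (auto simp: TG_def on_tuples_def tuples_def nth_append bij_is_inj surj_f_inv_f bij_is_surj)
qed

lemma mem_all_maps: "f \<in> all_maps \<longleftrightarrow> (\<exists>n\<ge>1. \<exists>m\<ge>1. f \<in> maps n m)"
  by (auto simp: all_maps_def)

lemma tau_in_maps: "f \<in> maps n m \<Longrightarrow> tau f \<in> maps n m"
  by (auto simp: maps_def tuples_def tau_def split: list.split)

lemma zeta_in_maps: "f \<in> maps n m \<Longrightarrow> zeta f \<in> maps n m"
  by (auto simp: maps_def tuples_def zeta_def)

lemma oplus_in_maps:
  "f \<in> maps n s \<Longrightarrow> g \<in> maps m t \<Longrightarrow> oplus n m f g \<in> maps (n + m) (s + t)"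
  by (auto simp: maps_def tuples_def oplus_def on_tuples_def)

lemma circ_in_maps:
  "f \<in> maps n s \<Longrightarrow> g \<in> maps m t \<Longrightarrow> k \<le> n \<Longrightarrow> k \<le> t \<Longrightarrow>
   circ k n m f g \<in> maps (n + m - k) (s + t - k)"
  by (auto simp: maps_def tuples_def circ_def on_tuples_def)

lemma toffoli_algebra_all_maps: "toffoli_algebra (all_maps :: ('a list \<Rightarrow> 'a list) set)"
proof -
  have "(i1 :: 'a list \<Rightarrow> 'a list) \<in> maps 1 1"
    by (auto simp: i1_def maps_def tuples_def on_tuples_def)
  then have "(i1 :: 'a list \<Rightarrow> 'a list) \<in> all_maps"
    unfolding mem_all_maps by blast
  moreover have "oplus n m f g \<in> all_maps"
    if "f \<in> maps n s" "g \<in> maps m t" "n \<ge> 1" "s \<ge> 1" for n m s t and f g :: "'a list \<Rightarrow> 'a list"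
    unfolding mem_all_maps using oplus_in_maps[OF that(1,2)] that(3,4) by (meson trans_le_add1)
  moreover have "circ k n m f g \<in> all_maps"
    if "f \<in> maps n s" "g \<in> maps m t" "k \<le> n" "k \<le> t" "m \<ge> 1" "s \<ge> 1"
    for k n m s t and f g :: "'a list \<Rightarrow> 'a list"
  proof -
    have "n + m - k \<ge> 1" "s + t - k \<ge> 1" using that by auto
    then show ?thesis unfolding mem_all_maps using circ_in_maps[OF that(1-4)] by blast
  qed
  moreover have "tau f \<in> all_maps" "zeta f \<in> all_maps" if "f \<in> all_maps" for f :: "'a list \<Rightarrow> 'a list"
    using that tau_in_maps zeta_in_maps unfolding mem_all_maps by blast+
  ultimately show ?thesis unfolding toffoli_algebra_def by blast
qed

lemma toffoli_algebra_Inter: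
  assumes "\<And>T. T \<in> \<T> \<Longrightarrow> toffoli_algebra T" "\<T> \<noteq> {}"
  shows "toffoli_algebra (\<Inter>\<T>)"
proof -
  from assms(2) obtain T0 where "T0 \<in> \<T>" by blast
  with assms(1) have a: "\<Inter>\<T> \<subseteq> all_maps" unfolding toffoli_algebra_def by blast
  have b: "i1 \<in> \<Inter>\<T>"
    using assms(1) unfolding toffoli_algebra_def by blast
  have c: "tau f \<in> \<Inter>\<T>" and d: "zeta f \<in> \<Inter>\<T>" if "f \<in> \<Inter>\<T>" for f
    using assms(1) that unfolding toffoli_algebra_def by blast+
  have e: "oplus n m f g \<in> \<Inter>\<T>"
    if "n \<ge> 1" "s \<ge> 1" "m \<ge> 1" "t \<ge> 1" "f \<in> \<Inter>\<T> \<inter> maps n s" "g \<in> \<Inter>\<T> \<inter> maps m t" for n s m t f g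
  proof
    fix T assume T: "T \<in> \<T>"
    then have "f \<in> T \<inter> maps n s" "g \<in> T \<inter> maps m t" using that by auto
    with assms(1)[OF T] that(1-4) show "oplus n m f g \<in> T"
      unfolding toffoli_algebra_def by metis
  qed
  have f: "circ k n m f g \<in> \<Inter>\<T>"
    if "n \<ge> 1" "s \<ge> 1" "m \<ge> 1" "t \<ge> 1" "f \<in> \<Inter>\<T> \<inter> maps n s" "g \<in> \<Inter>\<T> \<inter> maps m t"
      "1 \<le> k" "k \<le> n" "k \<le> t" for k n s m t f g
  proof
    fix T assume T: "T \<in> \<T>"
    then have "f \<in> T \<inter> maps n s" "g \<in> T \<inter> maps m t" using that by auto
    with assms(1)[OF T] that(1-4,7-9) show "circ k n m f g \<in> T"
      unfolding toffoli_algebra_def by metis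
  qed
  show ?thesis
    by (subst toffoli_algebra_def)
      (intro conjI allI impI ballI; (elim conjE)?; (rule a b c d e f; assumption)?)
qed

lemma toffoli_algebra_generated:
  assumes "F \<subseteq> all_maps"
  shows "toffoli_algebra (generated F)" "F \<subseteq> generated F"
    "\<And>T. toffoli_algebra T \<Longrightarrow> F \<subseteq> T \<Longrightarrow> generated F \<subseteq> T"
proof -
  show "toffoli_algebra (generated F)"
    unfolding generated_def
    using assms toffoli_algebra_all_maps by (intro toffoli_algebra_Inter) auto
qed (auto simp: generated_def)

end

theory Submission
  imports Defs
begin

text \<open>
  A gate with many controls is reduced to one with fewer controls by computing a conjunction into
  a storage wire. Choose \<open>d \<noteq> c\<close>, let \<open>\<sigma>\<close> exchange \<open>c\<close> and \<open>d\<close>, and let \<open>V\<close> be the gate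
  \<open>TG 3 \<sigma> c\<close>. If the third wire holds \<open>d\<close>, then after \<open>V\<close> it holds \<open>c\<close> exactly when the
  first two wires both hold \<open>c\<close>. So it can stand in for both of them as a single control: apply
  \<open>V\<close>, then the circuit for \<open>TG n \<alpha> c\<close> with the storage wire as its first input, then \<open>V\<close>
  again. As \<open>V\<close> is an involution and the circuit in the middle leaves the three wires of \<open>V\<close>
  alone, the second \<open>V\<close> restores the storage wire. This gives \<open>TG (n + 1) \<alpha> c\<close> at the cost of
  one storage wire, starting from \<open>TG 2 \<alpha> c\<close> without storage
  (lemmas \<open>TG_Suc_by_conjunction\<close> and \<open>TG_circuit\<close>).

  The storage wire is restored whatever it contained at the start; only the meaning of the
  conjunction depends on the initial value \<open>d\<close>. Hence the induction carries the statement that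
  the circuit changes no wire except the target, for arbitrary contents of all wires. The map
  on the storage required to be a bijection is therefore the identity.

  If the set has only one element, then there is no \<open>d \<noteq> c\<close>, but \<open>d = c\<close> works: every control
  and every conjunction then holds \<open>c\<close>.
\<close>

section \<open>Circuits in a Toffoli algebra\<close>

text \<open>
  The members of a Toffoli algebra take the dummy value outside their domain. Keeping this
  truncation inside the following predicate lets circuits be ordinary functions on lists, with
  ordinary composition.
\<close>

definition circuit :: "('a list \<Rightarrow> 'a list) set \<Rightarrow> nat \<Rightarrow> ('a list \<Rightarrow> 'a list) \<Rightarrow> bool" where
  "circuit T n h \<longleftrightarrow> n \<ge> 1 \<and> (\<forall>xs. length xs = n \<longrightarrow> length (h xs) = n) \<and> on_tuples n h \<in> T"

lemma circuit_on_tuples: "circuit T n h \<Longrightarrow> on_tuples n h \<in> T \<inter> maps n n"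
  by (auto simp: circuit_def maps_def on_tuples_def tuples_def)

lemma circuit_TG: "n \<ge> 1 \<Longrightarrow> TG n \<alpha> c \<in> T \<Longrightarrow> circuit T n (TG n \<alpha> c)"
proof -
  assume *: "n \<ge> 1" "TG n \<alpha> c \<in> T"
  have "on_tuples n (TG n \<alpha> c) = TG n \<alpha> c"
    by (auto simp: on_tuples_def TG_def)
  then show ?thesis
    using * TG_in_maps[OF *(1), of \<alpha> c] by (simp add: circuit_def maps_def tuples_def)
qed

lemma circuit_cong:
  assumes "circuit T n f" and "\<And>xs. length xs = n \<Longrightarrow> f xs = g xs"
  shows "circuit T n g"
proof -
  have "on_tuples n f = on_tuples n g"
    using assms(2) by (auto simp: on_tuples_def tuples_def)
  then show ?thesis using assms by (simp add: circuit_def)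
qed

lemma circuit_comp:
  assumes T: "toffoli_algebra T" and f: "circuit T n f" and g: "circuit T n g"
  shows "circuit T n (f \<circ> g)"
proof -
  have n: "n \<ge> 1" using f by (simp add: circuit_def)
  have "circ n n n (on_tuples n f) (on_tuples n g) \<in> T"
    using T n circuit_on_tuples[OF f] circuit_on_tuples[OF g]
    unfolding toffoli_algebra_def by blast
  moreover have "circ n n n (on_tuples n f) (on_tuples n g) = on_tuples n (f \<circ> g)"
    using g by (auto simp: circ_def on_tuples_def tuples_def circuit_def)
  ultimately show ?thesis using f g by (simp add: circuit_def)
qed

lemma circuit_beside:
  assumes T: "toffoli_algebra T" and f: "circuit T n f" and g: "circuit T m g"
  shows "circuit T (n + m) (\<lambda>xs. f (take n xs) @ g (drop n xs))"
proof -
  have nm: "n \<ge> 1" "m \<ge> 1" using f g by (simp_all add: circuit_def)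
  have "oplus n m (on_tuples n f) (on_tuples m g) \<in> T"
    using T nm circuit_on_tuples[OF f] circuit_on_tuples[OF g]
    unfolding toffoli_algebra_def by blast
  moreover have "oplus n m (on_tuples n f) (on_tuples m g)
      = on_tuples (n + m) (\<lambda>xs. f (take n xs) @ g (drop n xs))"
    by (auto simp: oplus_def on_tuples_def tuples_def)
  ultimately show ?thesis using f g by (simp add: circuit_def)
qed

lemma circuit_id:
  assumes T: "toffoli_algebra T" and "n \<ge> 1"
  shows "circuit T n (\<lambda>xs. xs)"
  using \<open>n \<ge> 1\<close>
proof (induction n rule: dec_induct)
  case base
  then show ?case using T by (simp add: circuit_def toffoli_algebra_def i1_def)
next
  case (step n)
  have "circuit T 1 (\<lambda>xs. xs)"
    using T by (simp add: circuit_def toffoli_algebra_def i1_def)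
  from circuit_beside[OF T step.IH this] show ?case by simp
qed

lemma circuit_rotate:
  assumes T: "toffoli_algebra T" and "n \<ge> 1"
  shows "circuit T n (rotate k)"
proof (induction k)
  case 0
  show ?case using circuit_id[OF assms] by (simp add: rotate_def id_def)
next
  case (Suc k)
  have "zeta (on_tuples n (rotate k)) \<in> T"
    using T Suc by (simp add: toffoli_algebra_def circuit_def)
  moreover have "zeta (on_tuples n (rotate k)) = on_tuples n (rotate (Suc k))"
    by (auto simp: zeta_def on_tuples_def tuples_def rotate1_rotate_swap)
  ultimately have "on_tuples n (rotate (Suc k)) \<in> T" by metis
  then show ?case using \<open>n \<ge> 1\<close> unfolding circuit_def by simp
qed

section \<open>Adding a control\<close>

lemma TG_Cons:
  assumes "length xs = n" "n \<ge> 1"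
  shows "TG (Suc n) \<alpha> c (x # xs) = x # (if x = c then TG n \<alpha> c xs else xs)"
  using assms by (cases n) (auto simp: TG_def on_tuples_def tuples_def All_less_Suc2)

lemma TG_1: "TG (Suc 0) \<alpha> c [x] = [\<alpha> x]"
  using TG_one[of \<alpha> c x] by simp

lemma TG_3: "TG 3 \<alpha> c [x, y, z] = [x, y, if x = c \<and> y = c then \<alpha> z else z]"
  by (simp add: numeral_3_eq_3 TG_Cons TG_1)

text \<open>
  The circuit \<open>add_control V h\<close> works on two controls, the input wires of \<open>h\<close> without the first one,
  and a storage wire in the last place. The rotation brings the storage wire next to the two
  controls, so that \<open>V\<close> acts on the first three wires, and it then is the first input of \<open>h\<close>.
\<close>

definition add_control ::
  "('a list \<Rightarrow> 'a list) \<Rightarrow> ('a list \<Rightarrow> 'a list) \<Rightarrow> 'a list \<Rightarrow> 'a list" where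
  "add_control V h =
     (\<lambda>xs. take 2 xs @ rotate 1 (drop 2 xs)) \<circ>
     (\<lambda>xs. V (take 3 xs) @ drop 3 xs) \<circ>
     (\<lambda>xs. take 2 xs @ h (drop 2 xs)) \<circ>
     (\<lambda>xs. V (take 3 xs) @ drop 3 xs) \<circ>
     (\<lambda>xs. take 2 xs @ rotate (length xs - 3) (drop 2 xs))"

lemma circuit_add_control:
  assumes T: "toffoli_algebra T" and V: "circuit T 3 V" and h: "circuit T n h" and n: "n \<ge> 2"
  shows "circuit T (n + 2) (add_control V h)"
proof -
  have id2: "circuit T 2 (\<lambda>xs. xs)" using circuit_id[OF T] by simp
  have rot: "circuit T (n + 2) (\<lambda>xs. take 2 xs @ rotate k (drop 2 xs))" for k
    using circuit_beside[OF T id2 circuit_rotate[OF T, of n k]] n by (simp add: add.commute)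
  have rot': "circuit T (n + 2) (\<lambda>xs. take 2 xs @ rotate (length xs - 3) (drop 2 xs))"
    by (rule circuit_cong[OF rot[of "n - 1"]]) simp
  have h': "circuit T (n + 2) (\<lambda>xs. take 2 xs @ h (drop 2 xs))"
    using circuit_beside[OF T id2 h] by (simp add: add.commute)
  have V': "circuit T (n + 2) (\<lambda>xs. V (take 3 xs) @ drop 3 xs)"
    using circuit_beside[OF T V circuit_id[OF T, of "n - 1"]] n by (simp add: eval_nat_numeral)
  show ?thesis
    unfolding add_control_def by (intro circuit_comp[OF T] rot rot' h' V')
qed

lemma add_control_apply:
  assumes "V [x, y, z] = [x, y, z']" "h (z' # ws) = z' # ws'" "V [x, y, z'] = [x, y, z]"
  shows "add_control V h (x # y # ws @ [z]) = x # y # ws' @ [z]"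
proof -
  have "rotate (length ws) (ws @ [z]) = z # ws"
    by (simp add: rotate_append)
  then show ?thesis
    using assms by (simp add: add_control_def eval_nat_numeral)
qed

text \<open>
  As \<open>n \<ge> 2\<close>, the target of \<open>h\<close> is not its first wire, so \<open>h\<close> passes on unchanged what the
  first \<open>V\<close> wrote into the storage wire, and the second \<open>V\<close> undoes it: this gives the first
  conclusion for arbitrary contents of the storage. In the second conclusion the value \<open>d\<close>
  matters, because the exchange of \<open>c\<close> and \<open>d\<close> turns it into the conjunction of the two controls.
\<close>

lemma TG_Suc_by_conjunction:
  fixes c d :: 'a
  defines "V \<equiv> TG 3 (id(c := d, d := c)) c"
  assumes n: "n \<ge> 2" and d: "d = c \<Longrightarrow> \<forall>x. x = c"
    and target: "\<And>zs. length zs = n + r \<Longrightarrow> \<exists>v. h zs = zs[n - 1 := v]"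
    and TG: "\<And>xs. length xs = n \<Longrightarrow> h (xs @ replicate r d) = TG n \<alpha> c xs @ replicate r d"
  shows "length zs = n + r + 2 \<Longrightarrow> \<exists>v. add_control V h zs = zs[n := v]"
    and "length xs = n + 1 \<Longrightarrow> add_control V h (xs @ replicate (Suc r) d)
           = TG (n + 1) \<alpha> c xs @ replicate (Suc r) d"
proof -
  define s where "s x y z = (if x = c \<and> y = c then (id(c := d, d := c)) z else z)" for x y z :: 'a
  have V: "V [x, y, z] = [x, y, s x y z]" for x y z
    by (simp add: V_def TG_3 s_def)
  have s_s: "s x y (s x y z) = z" for x y z
    by (simp add: s_def)
  have s_d: "s x y d = c \<longleftrightarrow> x = c \<and> y = c" for x y
    using d by (auto simp: s_def)
  have apply_h: "add_control V h (x # y # ws @ [z]) = x # y # ws' @ [z]"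
    if "h (s x y z # ws) = s x y z # ws'" for x y z ws ws'
    by (rule add_control_apply[of _ _ _ _ "s x y z"]) (simp_all add: V s_s that)
  obtain m where m: "n = Suc (Suc m)"
    using n by (metis add_2_eq_Suc le_Suc_ex)
  show "\<exists>v. add_control V h zs = zs[n := v]" if "length zs = n + r + 2"
  proof -
    from that obtain x y us where zs: "zs = x # y # us" "length us = Suc (n - 1 + r)"
      using m by (auto simp: length_Suc_conv)
    then obtain ws z where us: "us = ws @ [z]" "length ws = n - 1 + r"
      by (auto simp: length_Suc_conv_rev)
    obtain v where "h (s x y z # ws) = (s x y z # ws)[n - 1 := v]"
      using target[of "s x y z # ws"] us m by auto
    then have "h (s x y z # ws) = s x y z # ws[m := v]"
      by (simp add: m)
    from apply_h[OF this] have "add_control V h zs = zs[n := v]"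
      using us by (simp add: zs m list_update_append)
    then show ?thesis ..
  qed
  show "add_control V h (xs @ replicate (Suc r) d) = TG (n + 1) \<alpha> c xs @ replicate (Suc r) d"
    if "length xs = n + 1"
  proof -
    from that obtain x y us where xs: "xs = x # y # us" "length us = Suc m"
      using m by (auto simp: length_Suc_conv)
    have "h (s x y d # us @ replicate r d)
        = s x y d # (if x = c \<and> y = c then TG (Suc m) \<alpha> c us else us) @ replicate r d"
      using TG[of "s x y d # us"] xs by (simp add: m TG_Cons s_d)
    from apply_h[OF this] show ?thesis
      using xs by (simp add: m TG_Cons replicate_append_same)
  qed
qed

section \<open>Realising all Toffoli gates\<close>

text \<open>
  Every control beyond the first costs one storage wire, hence \<open>r\<close> of them for \<open>r + 2\<close> inputs.
  The statement about arbitrary contents is both what the next induction step needs for its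
  storage wire and what shows in the end that the storage is mapped bijectively.
\<close>

lemma TG_circuit:
  fixes c d :: 'a
  assumes T: "toffoli_algebra T" and d: "d = c \<Longrightarrow> \<forall>x. x = c"
    and V: "TG 3 (id(c := d, d := c)) c \<in> T" and TG2: "TG 2 \<alpha> c \<in> T"
  shows "\<exists>h. circuit T (r + 2 + r) h \<and>
    (\<forall>zs. length zs = r + 2 + r \<longrightarrow> (\<exists>v. h zs = zs[r + 1 := v])) \<and>
    (\<forall>xs. length xs = r + 2 \<longrightarrow> h (xs @ replicate r d) = TG (r + 2) \<alpha> c xs @ replicate r d)"
proof (induction r)
  case 0
  have "\<exists>v. TG 2 \<alpha> c zs = zs[1 := v]" if zs: "length zs = 2" for zs
  proof -
    obtain x y where "zs = [x, y]"
      using zs by (auto simp: length_Suc_conv eval_nat_numeral)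
    then have "TG 2 \<alpha> c zs = zs[1 := if x = c then \<alpha> y else y]"
      by (simp add: numeral_2_eq_2 TG_Cons TG_1)
    then show ?thesis ..
  qed
  then show ?case
    using circuit_TG[OF _ TG2] by (intro exI[of _ "TG 2 \<alpha> c"]) (simp add: numeral_2_eq_2)
next
  case (Suc r)
  then obtain h where h: "circuit T (r + 2 + r) h"
    and target: "\<And>zs. length zs = r + 2 + r \<Longrightarrow> \<exists>v. h zs = zs[r + 2 - 1 := v]"
    and TG: "\<And>xs. length xs = r + 2 \<Longrightarrow>
      h (xs @ replicate r d) = TG (r + 2) \<alpha> c xs @ replicate r d"
    by auto
  let ?g = "add_control (TG 3 (id(c := d, d := c)) c) h"
  have "circuit T (Suc r + 2 + Suc r) ?g"
    using circuit_add_control[OF T circuit_TG[OF _ V] h] by simp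
  moreover have "\<exists>v. ?g zs = zs[Suc r + 1 := v]" if "length zs = Suc r + 2 + Suc r" for zs
    using TG_Suc_by_conjunction(1)[OF _ d target TG, of zs] that by simp
  moreover have "?g (xs @ replicate (Suc r) d) = TG (Suc r + 2) \<alpha> c xs @ replicate (Suc r) d"
    if "length xs = Suc r + 2" for xs
    using TG_Suc_by_conjunction(2)[OF _ d target TG, of xs] that by simp
  ultimately show ?case by blast
qed

theorem theorem5p13:
  fixes c :: 'a and \<alpha> :: "'a \<Rightarrow> 'a" and n :: nat
  assumes "n \<ge> 1" and "bij \<alpha>"
  shows "realised_strong_temp {TG i \<alpha>' c | i \<alpha>'. i \<in> {1, 2, 3} \<and> bij \<alpha>'} n n (TG n \<alpha> c)"
proof -
  let ?F = "{TG i \<alpha>' c | i \<alpha>'. i \<in> {1, 2, 3} \<and> bij \<alpha>'}"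
  let ?T = "generated ?F"
  have F: "?F \<subseteq> all_maps"
  proof
    fix f assume "f \<in> ?F"
    then obtain i \<alpha>' where "f = TG i \<alpha>' c" "i \<ge> 1" by force
    then show "f \<in> all_maps" using TG_in_maps[of i \<alpha>' c] by (auto simp: mem_all_maps)
  qed
  have T: "toffoli_algebra ?T" by (rule toffoli_algebra_generated(1)[OF F])
  have gate: "TG i \<alpha>' c \<in> ?T" if "i \<in> {1, 2, 3}" "bij \<alpha>'" for i \<alpha>'
    using toffoli_algebra_generated(2)[OF F] that by blast
  have "\<exists>h r d. circuit ?T (n + r) h \<and>
    (\<forall>zs. length zs = n + r \<longrightarrow> (\<exists>v. h zs = zs[n - 1 := v])) \<and>
    (\<forall>xs. length xs = n \<longrightarrow> h (xs @ replicate r d) = TG n \<alpha> c xs @ replicate r d)"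
  proof (cases "n = 1")
    case True
    have "\<exists>v. TG 1 \<alpha> c zs = zs[0 := v]" if "length zs = 1" for zs
      using that by (auto simp: length_Suc_conv TG_1)
    then show ?thesis
      using True circuit_TG[OF _ gate[of 1 \<alpha>]] \<open>bij \<alpha>\<close>
      by (intro exI[of _ "TG 1 \<alpha> c"] exI[of _ 0]) simp
  next
    case False
    \<comment> \<open>A value other than \<open>c\<close> if there is one, and \<open>c\<close> itself on a one-element set.\<close>
    obtain d where d: "d = c \<Longrightarrow> \<forall>x. x = c" by metis
    have "id(c := d, d := c) \<circ> id(c := d, d := c) = id" by (auto simp: fun_eq_iff)
    then have "bij (id(c := d, d := c))" by (rule o_bij) fact
    then have V: "TG 3 (id(c := d, d := c)) c \<in> ?T" by (intro gate) simp
    have TG2: "TG 2 \<alpha> c \<in> ?T" using \<open>bij \<alpha>\<close> by (intro gate) simp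
    from False \<open>n \<ge> 1\<close> have n: "n - 2 + 2 = n" "n - 2 + 1 = n - 1" by auto
    show ?thesis
      using TG_circuit[OF T d V TG2, of "n - 2"] unfolding n by blast
  qed
  then obtain h r d where h: "circuit ?T (n + r) h"
    and target: "\<And>zs. length zs = n + r \<Longrightarrow> \<exists>v. h zs = zs[n - 1 := v]"
    and TG: "\<And>xs. length xs = n \<Longrightarrow> h (xs @ replicate r d) = TG n \<alpha> c xs @ replicate r d"
    by blast
  let ?f = "on_tuples (n + r) h"
  have len: "length (TG n \<alpha> c xs) = n" if "length xs = n" for xs
    using TG_in_maps[OF \<open>n \<ge> 1\<close>, of \<alpha> c] that by (simp add: maps_def tuples_def)
  have storage: "drop n (?f (bs @ xs)) = xs"
    if lens: "length bs = n" "length xs = r" for bs xs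
  proof -
    obtain v where "h (bs @ xs) = (bs @ xs)[n - 1 := v]"
      using target[of "bs @ xs"] lens by auto
    then show ?thesis
      using lens \<open>n \<ge> 1\<close> by (simp add: on_tuples_def tuples_def list_update_append)
  qed
  have bij: "bij_betw (\<lambda>xs. drop n (?f (bs @ xs))) (tuples r) (tuples r)" if "length bs = n" for bs
    by (rule bij_betw_cong[THEN iffD1, OF _ bij_betw_id]) (simp add: storage that tuples_def)
  show ?thesis
    unfolding realised_strong_temp_def
  proof (intro conjI exI[of _ "n + r"] exI[of _ ?f] exI[of _ "replicate r d"])
    show "?f \<in> ?T \<inter> maps (n + r) (n + r)" by (rule circuit_on_tuples[OF h])
    show "\<forall>xs\<in>tuples n. TG n \<alpha> c xs = take n (?f (xs @ replicate r d))"
      using TG len by (simp add: on_tuples_def tuples_def)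
    show "\<forall>xs\<in>tuples n. drop n (?f (xs @ replicate r d)) = replicate r d"
      using storage by (simp add: tuples_def)
    show "\<forall>bs\<in>tuples n. bij_betw (\<lambda>xs. drop n (?f (bs @ xs)))
        (tuples (n + r - n)) (tuples (n + r - n))"
      using bij by (simp add: tuples_def)
  qed (use F \<open>n \<ge> 1\<close> TG_in_maps in \<open>auto simp: tuples_def\<close>)
qed

end
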